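(* Let $\mu$ be a probability measure on $X$ and let $F:L^\infty(X)\to\mathbb{R}$, $F(f)=\log\left(\int_X \exp(f(x))\,\mu(dx)\right)$. Then for every $f\in L^\infty(X)$ $$F(f)=F^{**}(f)=\sup_{\gamma\in P_\mu(X)}\left\{\int_X f(x)\,\gamma(dx)-\int_X\log\left(\frac{d\gamma}{d\mu}(x)\right)\gamma(dx)\right\},$$ where $F^{**}$ denotes the Fenchel biconjugate of $F$. In particular, for every $f\in L^\infty(X)$, $$-\log\left(\int_X\exp(-f(x))\,\mu(dx)\right)=\inf_{\gamma\in P_\mu(X)}\left\{\int_X f(x)\,\gamma(dx)+\int_X\log\left(\frac{d\gamma}{d\mu}(x)\right)\gamma(dx)\right\}.$$
   Context: $X$ is a measurable space equipped with its Borel $\sigma$-algebra, and $L^\infty(X)=L^\infty(X,\mu)$. $P_\mu(X)$ is the set of probability measures on $X$ that are equivalent to $\mu$ (mutually absolutely continuous), regarded as a subset of the dual space $(L^\infty(X))'$ via integration; $\frac{d\gamma}{d\mu}$ is the Radon-Nikodym density. For a functional $F:N\to\overline{\mathbb{R}}$ on a normed space $N$ with dual $N'$, the Fenchel conjugate is $F^*:N'\to\overline{\mathbb{R}}$, $F^*(\ell)=\sup_{x\in N}(\langle \ell,x\rangle-F(x))$. The Fenchel biconjugate is $F^{**}=(F^* )^*$, restricted to $N$ via the canonical embedding of $N$ into its bidual, i.e. $F^{**}(x)=\sup_{\ell\in N'}(\langle\ell,x\rangle-F^*(\ell))$. *)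

theory Defs
  imports "HOL-Probability.Probability"
begin

text \<open>
  Since a type cannot depend on a measure, the elements of \<open>L\<^sup>\<infinity>(X,\<mu>)\<close> are handled through their
  representatives: measurable functions that are essentially bounded, with the essential
  supremum as (semi)norm. A linear functional that is bounded for this seminorm
  takes the same value on functions that agree almost everywhere, so the functionals below are
  those of the dual of the quotient space.
\<close>

definition Linf :: "'a measure \<Rightarrow> ('a \<Rightarrow> real) set" where
  "Linf M = {f \<in> borel_measurable M. esssup M (\<lambda>x. ereal \<bar>f x\<bar>) < \<infinity>}"

definition Linf_norm :: "'a measure \<Rightarrow> ('a \<Rightarrow> real) \<Rightarrow> real" where
  "Linf_norm M f = real_of_ereal (esssup M (\<lambda>x. ereal \<bar>f x\<bar>))"

text \<open>Only the values of a functional on \<open>Linf M\<close> matter; its values elsewhere are unconstrained.\<close>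

definition Linf_dual :: "'a measure \<Rightarrow> (('a \<Rightarrow> real) \<Rightarrow> real) set" where
  "Linf_dual M = {l.
     (\<forall>f\<in>Linf M. \<forall>g\<in>Linf M. l (\<lambda>x. f x + g x) = l f + l g) \<and>
     (\<forall>c. \<forall>f\<in>Linf M. l (\<lambda>x. c * f x) = c * l f) \<and>
     (\<exists>C. \<forall>f\<in>Linf M. \<bar>l f\<bar> \<le> C * Linf_norm M f)}"

definition fenchel_conj :: "'v set \<Rightarrow> ('v \<Rightarrow> ereal) \<Rightarrow> ('v \<Rightarrow> real) \<Rightarrow> ereal" where
  "fenchel_conj N F l = (SUP x\<in>N. ereal (l x) - F x)"

text \<open>The biconjugate is evaluated at \<open>\<lambda>l. l x\<close>, the image of \<open>x\<close> in the bidual.\<close>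

definition fenchel_biconj ::
    "'v set \<Rightarrow> ('v \<Rightarrow> real) set \<Rightarrow> ('v \<Rightarrow> ereal) \<Rightarrow> 'v \<Rightarrow> ereal" where
  "fenchel_biconj N N' F x = fenchel_conj N' (fenchel_conj N F) (\<lambda>l. l x)"

definition log_int_exp :: "'a measure \<Rightarrow> ('a \<Rightarrow> real) \<Rightarrow> real" where
  "log_int_exp M f = ln (\<integral>x. exp (f x) \<partial>M)"

definition equiv_probs :: "'a measure \<Rightarrow> 'a measure set" where
  "equiv_probs M = {G. prob_space G \<and> sets G = sets M \<and>
     absolutely_continuous M G \<and> absolutely_continuous G M}"

text \<open>
  The integral of \<open>log (d\<gamma>/d\<mu>)\<close> against \<open>\<gamma>\<close> may be \<open>+\<infinity>\<close>, where the Bochner integral would return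
  \<open>0\<close>. It is therefore taken as positive minus negative part in the extended
  reals; for this integrand the negative part is always finite, because \<open>t * ln t \<ge> - exp (-1)\<close>
  for \<open>t > 0\<close>, so \<open>\<infinity> - \<infinity>\<close> does not occur.
\<close>

definition ext_integral :: "'a measure \<Rightarrow> ('a \<Rightarrow> real) \<Rightarrow> ereal" where
  "ext_integral M h =
     enn2ereal (\<integral>\<^sup>+ x. ennreal (h x) \<partial>M) - enn2ereal (\<integral>\<^sup>+ x. ennreal (- h x) \<partial>M)"

text \<open>\<open>RN_deriv M G\<close> is \<open>dG/dM\<close>; it is finite and positive \<open>G\<close>-almost everywhere for
  \<open>G \<in> equiv_probs M\<close>, so the conventions for \<open>enn2real \<infinity>\<close> and \<open>ln 0\<close> play no role.\<close>

definition int_log_density :: "'a measure \<Rightarrow> 'a measure \<Rightarrow> ereal" where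
  "int_log_density M G = ext_integral G (\<lambda>x. ln (enn2real (RN_deriv M G x)))"

end

theory Submission
  imports Defs
begin

text \<open>
  Gibbs' inequality \<open>\<integral>f d\<gamma> - \<integral>log (d\<gamma>/d\<mu>) d\<gamma> \<le> F f\<close> follows by integrating \<open>ln t \<le> t - 1\<close> at
  \<open>t = exp (f - F f) / (d\<gamma>/d\<mu>)\<close> against \<open>\<gamma>\<close>, and the Gibbs measure \<open>d\<gamma>/d\<mu> = exp (f - F f)\<close>
  attains equality. Applied to all \<open>g\<close> at once, the inequality also bounds the conjugate of \<open>F\<close> at
  the functional \<open>g \<mapsto> \<integral>g d\<gamma>\<close> by the relative entropy of \<open>\<gamma>\<close>, so the Gibbs measure certifies
  \<open>F f \<le> F\<^sup>*\<^sup>* f\<close> directly and neither Hahn-Banach nor lower semicontinuity is needed.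
\<close>

section \<open>Fenchel conjugates and extended integrals\<close>

lemma fenchel_biconj_le:
  assumes "x \<in> N"
  shows "fenchel_biconj N N' F x \<le> F x"
  unfolding fenchel_biconj_def fenchel_conj_def
proof (rule SUP_least)
  fix l :: "'a \<Rightarrow> real"
  have "ereal (l x) - F x \<le> (SUP x\<in>N. ereal (l x) - F x)"
    using assms by (rule SUP_upper)
  then show "ereal (l x) - (SUP x\<in>N. ereal (l x) - F x) \<le> F x"
    \<comment> \<open>Young's inequality is rearranged by cases, since extended subtraction does not
      cancel freely: \<open>F x = -\<infinity>\<close> makes the supremum
      \<open>\<infinity>\<close>, hence the left side \<open>-\<infinity>\<close>.\<close>
    by (cases "F x"; cases "SUP x\<in>N. ereal (l x) - F x") auto
qed

lemma ext_integral_eq_integral: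
  assumes "integrable M h"
  shows "ext_integral M h = ereal (\<integral>x. h x \<partial>M)"
proof -
  obtain a b where "(\<integral>\<^sup>+x. ennreal (h x) \<partial>M) = ennreal a" "0 \<le> a"
      "(\<integral>\<^sup>+x. ennreal (- h x) \<partial>M) = ennreal b" "0 \<le> b"
    using assms unfolding real_integrable_def
    by (metis ennreal_cases infinity_ennreal_def)
  then show ?thesis
    by (simp add: ext_integral_def real_lebesgue_integral_def[OF assms])
qed

lemma ext_integral_cong_AE:
  assumes "AE x in M. g x = h x"
  shows "ext_integral M g = ext_integral M h"
proof -
  have "(\<integral>\<^sup>+x. ennreal (g x) \<partial>M) = (\<integral>\<^sup>+x. ennreal (h x) \<partial>M)"
       "(\<integral>\<^sup>+x. ennreal (- g x) \<partial>M) = (\<integral>\<^sup>+x. ennreal (- h x) \<partial>M)"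
    using assms by (auto intro!: nn_integral_cong_AE)
  then show ?thesis by (simp add: ext_integral_def)
qed

section \<open>Essentially bounded functions under equivalent measures\<close>

context prob_space
begin

lemma Linf_norm_ereal:
  assumes "f \<in> Linf M"
  shows "ereal (Linf_norm M f) = esssup M (\<lambda>x. ereal \<bar>f x\<bar>)"
proof -
  have "esssup M (\<lambda>x. 0 :: ereal) \<le> esssup M (\<lambda>x. ereal \<bar>f x\<bar>)"
    by (intro esssup_mono) auto
  then have "0 \<le> esssup M (\<lambda>x. ereal \<bar>f x\<bar>)"
    by (simp add: esssup_const emeasure_space_1)
  then show ?thesis
    using assms by (cases "esssup M (\<lambda>x. ereal \<bar>f x\<bar>)") (auto simp: Linf_def Linf_norm_def)
qed

lemma AE_le_Linf_norm:
  assumes "f \<in> Linf M"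
  shows "AE x in M. \<bar>f x\<bar> \<le> Linf_norm M f"
  using esssup_AE[of "\<lambda>x. ereal \<bar>f x\<bar>" M] by (simp flip: Linf_norm_ereal[OF assms])

lemma Linf_uminus: "f \<in> Linf M \<Longrightarrow> (\<lambda>x. - f x) \<in> Linf M"
  by (simp add: Linf_def)

lemma Linf_measurable: "f \<in> Linf M \<Longrightarrow> f \<in> borel_measurable M"
  by (simp add: Linf_def)

lemma equiv_probsD:
  assumes "G \<in> equiv_probs M"
  shows "prob_space G" "sets G = sets M" "absolutely_continuous M G" "absolutely_continuous G M"
  using assms by (auto simp: equiv_probs_def)

lemma AE_equiv_probs:
  assumes "G \<in> equiv_probs M" "AE x in M. P x"
  shows "AE x in G. P x"
  using equiv_probsD(2,3)[OF assms(1)] assms(2) by (rule absolutely_continuous_AE)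

text \<open>The essential bound for \<open>M\<close> also holds \<open>G\<close>-almost everywhere
  by absolute continuity, and \<open>G\<close> is finite.\<close>

lemma Linf_integrable_equiv:
  assumes "G \<in> equiv_probs M" "f \<in> Linf M"
  shows "integrable G f"
proof -
  interpret G: prob_space G by (rule equiv_probsD[OF assms(1)])
  have "f \<in> borel_measurable G"
    using Linf_measurable[OF assms(2)] measurable_cong_sets[OF equiv_probsD(2)[OF assms(1)]]
    by blast
  then show ?thesis
    using AE_equiv_probs[OF assms(1) AE_le_Linf_norm[OF assms(2)]]
    by (intro G.integrable_const_bound[where B = "Linf_norm M f"]) auto
qed

lemma abs_integral_equiv_le_Linf_norm:
  assumes "G \<in> equiv_probs M" "f \<in> Linf M"
  shows "\<bar>\<integral>x. f x \<partial>G\<bar> \<le> Linf_norm M f"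
proof -
  interpret G: prob_space G by (rule equiv_probsD[OF assms(1)])
  note int = Linf_integrable_equiv[OF assms]
  have "\<bar>\<integral>x. f x \<partial>G\<bar> \<le> (\<integral>x. \<bar>f x\<bar> \<partial>G)"
    by (rule integral_abs_bound)
  also have "\<dots> \<le> (\<integral>x. Linf_norm M f \<partial>G)"
    using int AE_equiv_probs[OF assms(1) AE_le_Linf_norm[OF assms(2)]]
    by (intro integral_mono_AE) auto
  finally show ?thesis by (simp add: G.prob_space)
qed

lemma integral_equiv_in_Linf_dual:
  assumes "G \<in> equiv_probs M"
  shows "(\<lambda>f. \<integral>x. f x \<partial>G) \<in> Linf_dual M"
  unfolding Linf_dual_def
\<comment> \<open>The bound \<open>C = 1\<close> is the total mass of \<open>G\<close>.\<close>
proof (intro CollectI conjI ballI allI exI[of _ 1])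
  fix f g assume "f \<in> Linf M" "g \<in> Linf M"
  then show "(\<integral>x. f x + g x \<partial>G) = (\<integral>x. f x \<partial>G) + (\<integral>x. g x \<partial>G)"
    using Linf_integrable_equiv[OF assms] by simp
next
  fix f assume "f \<in> Linf M"
  then show "\<bar>\<integral>x. f x \<partial>G\<bar> \<le> 1 * Linf_norm M f"
    using abs_integral_equiv_le_Linf_norm[OF assms] by simp
qed simp

section \<open>Exponential integrals\<close>

lemma integrable_exp_Linf:
  assumes "f \<in> Linf M"
  shows "integrable M (\<lambda>x. exp (f x))"
proof -
  have "AE x in M. norm (exp (f x)) \<le> exp (Linf_norm M f)"
    using AE_le_Linf_norm[OF assms] by eventually_elim auto
  then show ?thesis
    using Linf_measurable[OF assms] by (intro integrable_const_bound) auto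
qed

text \<open>A vanishing integral would force \<open>exp (f x) = 0\<close> almost everywhere, which a
  measure of mass 1 excludes. This makes the logarithm and the division by the integral
  meaningful.\<close>

lemma integral_exp_pos:
  assumes "f \<in> Linf M"
  shows "0 < (\<integral>x. exp (f x) \<partial>M)"
proof -
  have "(\<integral>x. exp (f x) \<partial>M) \<noteq> 0"
    using integral_nonneg_eq_0_iff_AE[OF integrable_exp_Linf[OF assms]] by simp
  then show ?thesis
    by (simp add: less_le)
qed

text \<open>Subtracting \<open>log_int_exp M f\<close> in the exponent divides by the integral of
  \<open>exp f\<close>, so the Gibbs density has mass 1.\<close>

lemma nn_integral_exp_normalized:
  assumes "f \<in> Linf M"
  shows "(\<integral>\<^sup>+x. ennreal (exp (f x - log_int_exp M f)) \<partial>M) = 1"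
proof -
  have eq: "exp (f x - log_int_exp M f) = exp (f x) / (\<integral>x. exp (f x) \<partial>M)" for x
    using integral_exp_pos[OF assms] by (simp add: log_int_exp_def exp_diff)
  have "(\<integral>\<^sup>+x. ennreal (exp (f x - log_int_exp M f)) \<partial>M)
      = ennreal (\<integral>x. exp (f x - log_int_exp M f) \<partial>M)"
    unfolding eq using integrable_exp_Linf[OF assms] integral_exp_pos[OF assms]
    by (intro nn_integral_eq_integral) auto
  also have "(\<integral>x. exp (f x - log_int_exp M f) \<partial>M) = 1"
    unfolding eq using integral_exp_pos[OF assms] by simp
  finally show ?thesis by simp
qed

section \<open>Densities and relative entropy\<close>

lemma RN_deriv_equiv:
  assumes "G \<in> equiv_probs M"
  shows "density M (RN_deriv M G) = G" "AE x in G. 0 < enn2real (RN_deriv M G x)"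
    "AE x in M. RN_deriv M G x \<noteq> \<infinity>"
proof -
  note G = equiv_probsD[OF assms]
  interpret G: prob_space G by (rule G)
  show dens: "density M (RN_deriv M G) = G"
    using G by (intro density_RN_deriv) auto
  show fin: "AE x in M. RN_deriv M G x \<noteq> \<infinity>"
    using G by (intro RN_deriv_finite) (auto intro: G.sigma_finite_measure_axioms)
  \<comment> \<open>A measure gives no mass to the set where its own density vanishes.\<close>
  have "AE x in density M (RN_deriv M G). 0 < RN_deriv M G x"
    by (subst AE_density) auto
  then have "AE x in G. 0 < RN_deriv M G x" by (simp only: dens)
  then show "AE x in G. 0 < enn2real (RN_deriv M G x)"
    using AE_equiv_probs[OF assms fin]
    by eventually_elim (auto simp: enn2real_positive_iff less_top)
qed

text \<open>Changing the measure to \<open>M\<close> multiplies by the density, which cancels the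
  denominator. Where the density is 0, the product is 0 and \<open>c x \<ge> 0\<close> suffices,
  whence an inequality.\<close>

lemma nn_integral_divide_RN_deriv_le:
  assumes G: "G \<in> equiv_probs M" and [measurable]: "c \<in> borel_measurable M"
    and nn: "\<And>x. 0 \<le> c x"
  shows "(\<integral>\<^sup>+x. ennreal (c x / enn2real (RN_deriv M G x)) \<partial>G) \<le> (\<integral>\<^sup>+x. ennreal (c x) \<partial>M)"
proof -
  have "(\<integral>\<^sup>+x. ennreal (c x / enn2real (RN_deriv M G x)) \<partial>G)
      = (\<integral>\<^sup>+x. ennreal (c x / enn2real (RN_deriv M G x)) \<partial>density M (RN_deriv M G))"
    by (simp only: RN_deriv_equiv(1)[OF G])
  also have "\<dots> = (\<integral>\<^sup>+x. RN_deriv M G x * ennreal (c x / enn2real (RN_deriv M G x)) \<partial>M)"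
    by (subst nn_integral_density) auto
  also have "\<dots> \<le> (\<integral>\<^sup>+x. ennreal (c x) \<partial>M)"
  proof (rule nn_integral_mono_AE)
    show "AE x in M. RN_deriv M G x * ennreal (c x / enn2real (RN_deriv M G x)) \<le> ennreal (c x)"
      using RN_deriv_equiv(3)[OF G]
    proof eventually_elim
      case (elim x)
      then obtain d where "RN_deriv M G x = ennreal d" "0 \<le> d"
        by (cases "RN_deriv M G x") auto
      then show ?case using nn[of x] by (simp flip: ennreal_mult)
    qed
  qed
  finally show ?thesis .
qed

text \<open>With \<open>D\<close> the density, \<open>- ln D = ln (1 / D) \<le> 1 / D - 1\<close>,
  and \<open>1 / D\<close> has \<open>G\<close>-integral at most the mass of \<open>M\<close>. So
  the negative part is finite, and only the positive part decides between the two cases.\<close>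

lemma int_log_density_cases [consumes 1, case_names infinite finite]:
  assumes G: "G \<in> equiv_probs M"
  defines "h \<equiv> \<lambda>x. ln (enn2real (RN_deriv M G x))"
  obtains (infinite) "int_log_density M G = \<infinity>"
    | (finite) "integrable G h" "int_log_density M G = ereal (\<integral>x. h x \<partial>G)"
proof -
  have meas: "h \<in> borel_measurable G"
    unfolding h_def measurable_cong_sets[OF equiv_probsD(2)[OF G] refl] by measurable
  have "(\<integral>\<^sup>+x. ennreal (- h x) \<partial>G) \<le> (\<integral>\<^sup>+x. ennreal (1 / enn2real (RN_deriv M G x)) \<partial>G)"
  proof (rule nn_integral_mono_AE)
    show "AE x in G. ennreal (- h x) \<le> ennreal (1 / enn2real (RN_deriv M G x))"
      using RN_deriv_equiv(2)[OF G]
    proof eventually_elim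
      case (elim x)
      then show ?case
        using ln_le_minus_one[of "1 / enn2real (RN_deriv M G x)"]
        by (intro ennreal_leI) (simp add: h_def ln_div)
    qed
  qed
  also have "\<dots> \<le> (\<integral>\<^sup>+x. ennreal 1 \<partial>M)"
    by (rule nn_integral_divide_RN_deriv_le[OF G]) auto
  finally have neg: "(\<integral>\<^sup>+x. ennreal (- h x) \<partial>G) \<le> 1"
    by (simp add: emeasure_space_1)
  then have neg': "(\<integral>\<^sup>+x. ennreal (- h x) \<partial>G) \<noteq> \<infinity>"
    by (auto simp: top_unique)
  show thesis
  proof (cases "(\<integral>\<^sup>+x. ennreal (h x) \<partial>G) = \<infinity>")
    case True
    obtain b where "(\<integral>\<^sup>+x. ennreal (- h x) \<partial>G) = ennreal b" "0 \<le> b"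
      using neg' by (metis ennreal_cases infinity_ennreal_def)
    then show ?thesis
      using True by (intro infinite) (simp add: int_log_density_def ext_integral_def h_def)
  next
    case False
    then have "integrable G h"
      using meas neg' by (simp add: real_integrable_def)
    then show ?thesis
      using ext_integral_eq_integral[of G h]
      by (intro finite) (auto simp: int_log_density_def h_def)
  qed
qed

section \<open>The Gibbs variational principle\<close>

lemma gibbs_inequality:
  assumes G: "G \<in> equiv_probs M" and f: "f \<in> Linf M"
  shows "ereal (\<integral>x. f x \<partial>G) - int_log_density M G \<le> ereal (log_int_exp M f)"
  using G
proof (cases rule: int_log_density_cases)
  case finite
  interpret G: prob_space G by (rule equiv_probsD[OF G])
  note [measurable] = Linf_measurable[OF f]
  let ?D = "\<lambda>x. enn2real (RN_deriv M G x)"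
  let ?F = "log_int_exp M f"
  let ?q = "\<lambda>x. exp (f x - ?F) / ?D x"
  \<comment> \<open>\<open>?q\<close> is the Gibbs density of \<open>f\<close> divided by that of
    \<open>G\<close>; its \<open>G\<close>-integral is at most the mass of the Gibbs
    measure.\<close>
  have q_le: "(\<integral>\<^sup>+x. ennreal (?q x) \<partial>G) \<le> 1"
    using nn_integral_divide_RN_deriv_le[OF G, of "\<lambda>x. exp (f x - ?F)"]
    by (simp add: nn_integral_exp_normalized[OF f])
  have "?q \<in> borel_measurable M" by measurable
  then have "?q \<in> borel_measurable G"
    unfolding measurable_cong_sets[OF equiv_probsD(2)[OF G] refl] .
  then have int_q: "integrable G ?q"
    using q_le by (intro integrableI_nonneg) (auto intro: le_less_trans)
  have "ennreal (\<integral>x. ?q x \<partial>G) \<le> 1"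
    using q_le int_q by (subst (asm) nn_integral_eq_integral) auto
  then have q_le': "(\<integral>x. ?q x \<partial>G) \<le> 1" by simp
  note int_f = Linf_integrable_equiv[OF G f]
  have "(\<integral>x. f x - ?F - ln (?D x) \<partial>G) \<le> (\<integral>x. ?q x - 1 \<partial>G)"
  proof (rule integral_mono_AE)
    show "AE x in G. f x - ?F - ln (?D x) \<le> ?q x - 1"
      using RN_deriv_equiv(2)[OF G]
    proof eventually_elim
      case (elim x)
      then show ?case using ln_le_minus_one[of "?q x"] by (simp add: ln_div)
    qed
  qed (use int_f int_q finite in auto)
  also have "\<dots> \<le> 0"
    using q_le' int_q by (simp add: G.prob_space)
  finally have "(\<integral>x. f x \<partial>G) - (\<integral>x. ln (?D x) \<partial>G) \<le> ?F"
    using int_f finite by (simp add: G.prob_space)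
  then show ?thesis using finite by simp
\<comment> \<open>Infinite entropy makes the left side \<open>-\<infinity>\<close>.\<close>
qed simp

lemma gibbs_measure_attains:
  assumes f: "f \<in> Linf M"
  obtains G where "G \<in> equiv_probs M"
    "ereal (\<integral>x. f x \<partial>G) - int_log_density M G = ereal (log_int_exp M f)"
proof -
  let ?F = "log_int_exp M f"
  define d where "d = (\<lambda>x. ennreal (exp (f x - ?F)))"
  define G where "G = density M d"
  have [measurable]: "d \<in> borel_measurable M"
    using Linf_measurable[OF f] by (simp add: d_def)
  have d_pos: "d x \<noteq> 0" for x by (simp add: d_def)
  have "emeasure G (space G) = 1"
    using nn_integral_exp_normalized[OF f]
    by (simp add: G_def emeasure_density nn_integral_set_ennreal[symmetric] flip: d_def)
  then interpret G: prob_space G by (rule prob_spaceI)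
  have G: "G \<in> equiv_probs M"
    unfolding equiv_probs_def
  proof (intro CollectI conjI)
    show "prob_space G" by (rule G.prob_space_axioms)
    show "sets G = sets M" by (simp add: G_def)
    show "absolutely_continuous M G"
      unfolding G_def by (rule absolutely_continuousI_density) simp
    show "absolutely_continuous G M"
      unfolding absolutely_continuous_def
    proof
      fix A assume "A \<in> null_sets G"
      \<comment> \<open>On a \<open>G\<close>-null set the density vanishes \<open>M\<close>-almost
        everywhere; as it is nowhere zero, the set is \<open>M\<close>-null.\<close>
      then show "A \<in> null_sets M"
        using d_pos by (simp add: G_def null_sets_density_iff AE_iff_null_sets)
    qed
  qed
  have "AE x in M. d x = RN_deriv M G x"
    by (rule RN_deriv_unique) (simp_all add: G_def)
  then have "AE x in G. d x = RN_deriv M G x"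
    by (rule AE_equiv_probs[OF G])
  then have "AE x in G. ln (enn2real (RN_deriv M G x)) = f x - ?F"
    unfolding d_def by eventually_elim (metis enn2real_ennreal exp_ge_zero ln_exp)
  then have "int_log_density M G = ext_integral G (\<lambda>x. f x - ?F)"
    unfolding int_log_density_def by (rule ext_integral_cong_AE)
  \<comment> \<open>The log-density \<open>f - ?F\<close> is \<open>G\<close>-integrable, so the
    entropy is real and the integral of \<open>f\<close> cancels exactly.\<close>
  also have "\<dots> = ereal ((\<integral>x. f x \<partial>G) - ?F)"
    using Linf_integrable_equiv[OF G f] by (simp add: ext_integral_eq_integral G.prob_space)
  finally show thesis using G that by simp
qed

section \<open>Duality formulas\<close>

lemma log_int_exp_eq_SUP:
  assumes "f \<in> Linf M"
  shows "ereal (log_int_exp M f)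
    = (SUP G\<in>equiv_probs M. ereal (\<integral>x. f x \<partial>G) - int_log_density M G)"
proof (rule antisym)
  show "ereal (log_int_exp M f)
      \<le> (SUP G\<in>equiv_probs M. ereal (\<integral>x. f x \<partial>G) - int_log_density M G)"
    by (rule gibbs_measure_attains[OF assms], rule SUP_upper2) auto
qed (blast intro: SUP_least gibbs_inequality assms)

text \<open>This is Gibbs' inequality for every \<open>g\<close>, with entropy and
  \<open>log_int_exp M g\<close> exchanged between the sides; the case split covers infinite
  entropy.\<close>

lemma fenchel_conj_integral_le:
  assumes G: "G \<in> equiv_probs M"
  shows "fenchel_conj (Linf M) (\<lambda>g. ereal (log_int_exp M g)) (\<lambda>g. \<integral>x. g x \<partial>G)
    \<le> int_log_density M G"
  unfolding fenchel_conj_def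
proof (rule SUP_least)
  fix g assume "g \<in> Linf M"
  from gibbs_inequality[OF G this]
  show "ereal (\<integral>x. g x \<partial>G) - ereal (log_int_exp M g) \<le> int_log_density M G"
    by (cases "int_log_density M G") auto
qed

lemma log_int_exp_eq_biconj:
  assumes f: "f \<in> Linf M"
  shows "ereal (log_int_exp M f)
    = fenchel_biconj (Linf M) (Linf_dual M) (\<lambda>g. ereal (log_int_exp M g)) f"
proof (rule antisym)
  let ?F = "\<lambda>g. ereal (log_int_exp M g)"
  obtain G where G: "G \<in> equiv_probs M"
    and eq: "ereal (\<integral>x. f x \<partial>G) - int_log_density M G = ereal (log_int_exp M f)"
    using gibbs_measure_attains[OF f] .
  \<comment> \<open>Replacing the entropy by the smaller conjugate can only increase the difference,
    which is then one term of the supremum defining the biconjugate.\<close>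
  have "ereal (\<integral>x. f x \<partial>G) - int_log_density M G
      \<le> ereal (\<integral>x. f x \<partial>G) - fenchel_conj (Linf M) ?F (\<lambda>g. \<integral>x. g x \<partial>G)"
    by (intro ereal_minus_mono fenchel_conj_integral_le G order_refl)
  also have "\<dots> \<le> fenchel_biconj (Linf M) (Linf_dual M) ?F f"
    unfolding fenchel_biconj_def
    by (subst (2) fenchel_conj_def, rule SUP_upper2[OF integral_equiv_in_Linf_dual[OF G]]) simp
  finally show "ereal (log_int_exp M f) \<le> fenchel_biconj (Linf M) (Linf_dual M) ?F f"
    by (simp only: eq)
qed (rule fenchel_biconj_le[OF f])

text \<open>The supremum formula at \<open>- f\<close> is negated, turning the supremum into an
  infimum.\<close>

lemma neg_log_int_exp_uminus_eq_INF:
  assumes "f \<in> Linf M"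
  shows "ereal (- ln (\<integral>x. exp (- f x) \<partial>M))
    = (INF G\<in>equiv_probs M. ereal (\<integral>x. f x \<partial>G) + int_log_density M G)"
proof -
  have "ereal (- ln (\<integral>x. exp (- f x) \<partial>M)) = - ereal (log_int_exp M (\<lambda>x. - f x))"
    by (simp add: log_int_exp_def)
  also have "\<dots> = - (SUP G\<in>equiv_probs M. ereal (\<integral>x. - f x \<partial>G) - int_log_density M G)"
    by (simp only: log_int_exp_eq_SUP[OF Linf_uminus[OF assms]])
  also have "\<dots> = (INF G\<in>equiv_probs M. - (ereal (\<integral>x. - f x \<partial>G) - int_log_density M G))"
    by (rule ereal_INF_uminus_eq[symmetric])
  also have "\<dots> = (INF G\<in>equiv_probs M. ereal (\<integral>x. f x \<partial>G) + int_log_density M G)"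
  proof (rule INF_cong[OF refl])
    fix G
    \<comment> \<open>The integral of \<open>f\<close> is a real number, so negation distributes
      even when the entropy is infinite.\<close>
    show "- (ereal (\<integral>x. - f x \<partial>G) - int_log_density M G)
        = ereal (\<integral>x. f x \<partial>G) + int_log_density M G"
      by (cases "int_log_density M G") auto
  qed
  finally show ?thesis .
qed

end

theorem theorem2p2:
  fixes M :: "'a measure"
  assumes "prob_space M"
  shows "(\<forall>f\<in>Linf M.
            ereal (log_int_exp M f)
              = fenchel_biconj (Linf M) (Linf_dual M) (\<lambda>g. ereal (log_int_exp M g)) f \<and>
            fenchel_biconj (Linf M) (Linf_dual M) (\<lambda>g. ereal (log_int_exp M g)) f
              = (SUP G\<in>equiv_probs M. ereal (\<integral>x. f x \<partial>G) - int_log_density M G)) \<and>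
         (\<forall>f\<in>Linf M.
            ereal (- ln (\<integral>x. exp (- f x) \<partial>M))
              = (INF G\<in>equiv_probs M. ereal (\<integral>x. f x \<partial>G) + int_log_density M G))"
proof -
  interpret prob_space M by fact
  show ?thesis
    \<comment> \<open>The second equality chains the biconjugate identity, reversed, with the
      supremum formula.\<close>
    by (intro conjI ballI log_int_exp_eq_biconj neg_log_int_exp_uminus_eq_INF
      trans[OF log_int_exp_eq_biconj[symmetric] log_int_exp_eq_SUP])
qed

end
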